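(* Let $G/H$ be the scalar manifold with $G\subset Sp(2n_v,\mathbb R)$, and let $f,h$ be the $n_v\times n_v$ complex matrix functions (on a coordinate patch of $G/H$) obtained from the embedded coset representative, with $U=\frac1{\sqrt2}\begin{pmatrix} f+ih&\bar f+i\bar h\\ f-ih&\bar f-i\bar h\end{pmatrix}$. Then the left-invariant form $\Gamma=U^{-1}dU$ satisfies $d\Gamma+\Gamma\wedge\Gamma=0$ (it is a flat connection) and has the form $$\Gamma=\begin{pmatrix}\Omega&\bar{\mathcal P}\\ \mathcal P&\bar\Omega\end{pmatrix},\qquad \Omega=i(f^\dagger dh-h^\dagger df),\qquad \mathcal P=-i(f^t dh-h^t df),$$ where $\Omega=\omega$ is the $H$-connection and $\mathcal P$ is the embedded vielbein of $G/H$. Moreover, writing $\nabla V=dV-V\omega$, one has $\nabla f=\bar f\,\mathcal P$ and $\nabla h=\bar h\,\mathcal P$, and for every constant real charge vector $(g^\Lambda,e_\Lambda)$ the central and matter charges $$Z_{AB}=h_{\Lambda AB}g^\Lambda-f^\Lambda_{AB}e_\Lambda,\qquad Z_I=h_{\Lambda I}g^\Lambda-f^\Lambda_Ie_\Lambda$$ satisfy $$\nabla Z_{AB}=\bar Z^{I}P_{I\,AB}+\tfrac12\bar Z^{CD}P_{CD\,AB},\qquad \nabla Z_I=\tfrac12\bar Z^{AB}P_{AB\,I}+\bar Z^{J}P_{JI}.$$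
   Context: $G$ is a Lie group realized as a subgroup of $Sp(2n_v,\mathbb R)$, and $G/H$ is a symmetric space with Cartan decomposition $\mathrm{Lie}(G)=\mathbb H+\mathbb K$. A coset representative is a smooth local section $S=\begin{pmatrix}A&B\\ C&D\end{pmatrix}$ of $G\to G/H$, with values in $Sp(2n_v,\mathbb R)$: $A^tC=C^tA$, $B^tD=D^tB$, $A^tD-C^tB=1$. Set $f=\frac1{\sqrt2}(A-iB)$, $h=\frac1{\sqrt2}(C-iD)$, and $\mathcal A=\begin{pmatrix}1&1\\ -i&i\end{pmatrix}$, so that $U=\mathcal A^{-1}S\mathcal A$. Write $H=H_{Aut}\times H_{matter}$. The rows of $f,h$ are labelled by $\Lambda=1,\dots,n_v$. The columns are labelled by pairs: antisymmetric pairs $AB$ (with $1\le A,B\le N$, the independent ones being $A<B$) and matter indices $I=1,\dots,n$. Thus $f=(f^\Lambda_{AB},f^\Lambda_I)$, $h=(h_{\Lambda AB},h_{\Lambda I})$. The factor $\frac12$ in front of a sum over repeated antisymmetric pairs compensates for summing over all $A,B$. The embedding is such that, after conjugation by $\mathcal A$, elements of $\mathbb H$ have the form $\mathrm{diag}(w,\bar w)$ with $w$ block-diagonal with respect to the splitting of column labels into pairs $AB$ and indices $I$, while elements of $\mathbb K$ are block off-diagonal $\begin{pmatrix}0&\bar p\\ p&0\end{pmatrix}$. The $H$-connection $\omega$ and the embedded vielbein are the corresponding components of $U^{-1}dU$ along $\mathbb H$ and $\mathbb K$. The blocks of the embedded vielbein are written $\mathcal P=\begin{pmatrix}P_{AB\,CD}&P_{AB\,J}\\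 P_{I\,CD}&P_{IJ}\end{pmatrix}$. Bars denote complex conjugation, and $\bar Z^{AB}=(Z_{AB})^*$, $\bar Z^I=(Z_I)^*$. *)

theory Defs
  imports "HOL-Analysis.Analysis"
begin

section \<open>Smooth maps\<close>

text \<open>On an open set of a Euclidean space, iterated directional derivatives give the usual
  classes of k times continuously differentiable maps.\<close>

primrec Ck_on :: "nat \<Rightarrow> ('a::euclidean_space \<Rightarrow> 'b::real_normed_vector) \<Rightarrow> 'a set \<Rightarrow> bool" where
  "Ck_on 0 F X \<longleftrightarrow> continuous_on X F"
| "Ck_on (Suc k) F X \<longleftrightarrow>
     F differentiable_on X \<and> (\<forall>v. Ck_on k (\<lambda>x. frechet_derivative F (at x) v) X)"

definition smooth_on :: "('a::euclidean_space \<Rightarrow> 'b::real_normed_vector) \<Rightarrow> 'a set \<Rightarrow> bool" where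
  "smooth_on F X \<longleftrightarrow> (\<forall>k. Ck_on k F X)"

section \<open>Block matrices\<close>

definition from_blocks ::
  "'a^'m^'m \<Rightarrow> 'a^'m^'m \<Rightarrow> 'a^'m^'m \<Rightarrow> 'a^'m^'m \<Rightarrow> 'a^('m + 'm)^('m + 'm)" where
  "from_blocks A B C D = (\<chi> i j.
     (case i of
        Inl a \<Rightarrow> (case j of Inl b \<Rightarrow> A $ a $ b | Inr b \<Rightarrow> B $ a $ b)
      | Inr a \<Rightarrow> (case j of Inl b \<Rightarrow> C $ a $ b | Inr b \<Rightarrow> D $ a $ b)))"

definition blockA :: "'a^('m + 'm)^('m + 'm) \<Rightarrow> 'a^'m^'m" where
  "blockA M = (\<chi> a b. M $ Inl a $ Inl b)"
definition blockB :: "'a^('m + 'm)^('m + 'm) \<Rightarrow> 'a^'m^'m" where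
  "blockB M = (\<chi> a b. M $ Inl a $ Inr b)"
definition blockC :: "'a^('m + 'm)^('m + 'm) \<Rightarrow> 'a^'m^'m" where
  "blockC M = (\<chi> a b. M $ Inr a $ Inl b)"
definition blockD :: "'a^('m + 'm)^('m + 'm) \<Rightarrow> 'a^'m^'m" where
  "blockD M = (\<chi> a b. M $ Inr a $ Inr b)"

definition cscale :: "complex \<Rightarrow> complex^'m^'n \<Rightarrow> complex^'m^'n" where
  "cscale c M = map_matrix (\<lambda>z. c * z) M"

definition mcnj :: "complex^'m^'n \<Rightarrow> complex^'m^'n" where
  "mcnj M = map_matrix cnj M"

definition dagger :: "complex^'m^'n \<Rightarrow> complex^'n^'m" where
  "dagger M = transpose (mcnj M)"

definition cmat :: "real^'m^'n \<Rightarrow> complex^'m^'n" where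
  "cmat M = map_matrix complex_of_real M"

section \<open>Matrix Lie groups\<close>

definition symplectic_group :: "(real^('m::finite + 'm)^('m + 'm)) set" where
  "symplectic_group = {S.
     transpose (blockA S) ** blockC S = transpose (blockC S) ** blockA S \<and>
     transpose (blockB S) ** blockD S = transpose (blockD S) ** blockB S \<and>
     transpose (blockA S) ** blockD S - transpose (blockC S) ** blockB S = mat 1}"

text \<open>Every group below lies in the symplectic group, which is closed in the space of all
  matrices, so closedness among matrices and in the ambient group agree.\<close>

definition matrix_lie_group :: "(real^'n::finite^'n) set \<Rightarrow> bool" where
  "matrix_lie_group G \<longleftrightarrow>
     closed G \<and> mat 1 \<in> G \<and>
     (\<forall>a\<in>G. \<forall>b\<in>G. a ** b \<in> G) \<and>
     (\<forall>a\<in>G. invertible a \<and> matrix_inv a \<in> G)"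

definition curve_in_group ::
  "(real^'n::finite^'n) set \<Rightarrow> (real \<Rightarrow> real^'n^'n) \<Rightarrow> real^'n^'n \<Rightarrow> bool" where
  "curve_in_group G \<gamma> X \<longleftrightarrow>
     (\<exists>\<epsilon>>0. smooth_on \<gamma> {-\<epsilon><..<\<epsilon>} \<and> \<gamma> ` {-\<epsilon><..<\<epsilon>} \<subseteq> G) \<and>
     \<gamma> 0 = mat 1 \<and> (\<gamma> has_vector_derivative X) (at 0)"

definition lie_algebra :: "(real^'n::finite^'n) set \<Rightarrow> (real^'n^'n) set" where
  "lie_algebra G = {X. \<exists>\<gamma>. curve_in_group G \<gamma> X}"

text \<open>\<open>H\<close> is the product of two commuting closed subgroups, locally a direct product. As usual for
  isotropy groups of supergravity scalar manifolds, products are understood up to a discrete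
  intersection of the factors; a literal direct product (trivial intersection) is a special
  case.\<close>

definition product_group ::
  "(real^'n::finite^'n) set \<Rightarrow> (real^'n^'n) set \<Rightarrow> (real^'n^'n) set \<Rightarrow> bool" where
  "product_group H H1 H2 \<longleftrightarrow>
     matrix_lie_group H1 \<and> matrix_lie_group H2 \<and>
     (\<forall>a\<in>H1. \<forall>b\<in>H2. a ** b = b ** a) \<and>
     lie_algebra H1 \<inter> lie_algebra H2 = {0} \<and>
     H = {a ** b |a b. a \<in> H1 \<and> b \<in> H2}"

section \<open>Symmetric spaces and Cartan decompositions\<close>

text \<open>Continuous homomorphisms of Lie groups are smooth, so continuity of the involution
  suffices.\<close>

definition symmetric_pair ::
  "(real^'n::finite^'n) set \<Rightarrow> (real^'n^'n) set \<Rightarrow> (real^'n^'n \<Rightarrow> real^'n^'n) \<Rightarrow> bool" where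
  "symmetric_pair G H \<sigma> \<longleftrightarrow>
     matrix_lie_group G \<and> matrix_lie_group H \<and> H \<subseteq> G \<and>
     continuous_on G \<sigma> \<and>
     (\<forall>a\<in>G. \<sigma> a \<in> G \<and> \<sigma> (\<sigma> a) = a) \<and>
     (\<forall>a\<in>G. \<forall>b\<in>G. \<sigma> (a ** b) = \<sigma> a ** \<sigma> b) \<and>
     connected_component_set {a \<in> G. \<sigma> a = a} (mat 1) \<subseteq> H \<and>
     H \<subseteq> {a \<in> G. \<sigma> a = a}"

text \<open>The eigenspace of the differential of \<open>\<sigma>\<close> at the identity for the eigenvalue -1.\<close>

definition minus_eigenspace ::
  "(real^'n::finite^'n) set \<Rightarrow> (real^'n^'n \<Rightarrow> real^'n^'n) \<Rightarrow> (real^'n^'n) set" where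
  "minus_eigenspace G \<sigma> =
     {X. \<exists>\<gamma>. curve_in_group G \<gamma> X \<and> ((\<lambda>t. \<sigma> (\<gamma> t)) has_vector_derivative - X) (at 0)}"

definition commutator :: "real^'n::finite^'n \<Rightarrow> real^'n^'n \<Rightarrow> real^'n^'n" where
  "commutator X Y = X ** Y - Y ** X"

definition cartan_decomposition ::
  "(real^'n::finite^'n) set \<Rightarrow> (real^'n^'n) set \<Rightarrow> (real^'n^'n) set \<Rightarrow> bool" where
  "cartan_decomposition \<gg> \<hh> \<kk> \<longleftrightarrow>
     subspace \<hh> \<and> subspace \<kk> \<and> \<hh> \<inter> \<kk> = {0} \<and> \<gg> = {X + Y |X Y. X \<in> \<hh> \<and> Y \<in> \<kk>} \<and>
     (\<forall>X\<in>\<hh>. \<forall>Y\<in>\<hh>. commutator X Y \<in> \<hh>) \<and>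
     (\<forall>X\<in>\<hh>. \<forall>Y\<in>\<kk>. commutator X Y \<in> \<kk>) \<and>
     (\<forall>X\<in>\<kk>. \<forall>Y\<in>\<kk>. commutator X Y \<in> \<hh>)"

section \<open>Matrix-valued forms and coset representatives\<close>

text \<open>A matrix-valued 1-form takes a point and a tangent vector; a 2-form takes a point and two
  tangent vectors.\<close>

abbreviation ext_d :: "('x::real_normed_vector \<Rightarrow> 'b::real_normed_vector) \<Rightarrow> 'x \<Rightarrow> 'x \<Rightarrow> 'b" where
  "ext_d F x v \<equiv> frechet_derivative F (at x) v"

definition ext_d1 ::
  "('x::real_normed_vector \<Rightarrow> 'x \<Rightarrow> 'b::real_normed_vector) \<Rightarrow> 'x \<Rightarrow> 'x \<Rightarrow> 'x \<Rightarrow> 'b" where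
  "ext_d1 \<theta> x u v = ext_d (\<lambda>y. \<theta> y v) x u - ext_d (\<lambda>y. \<theta> y u) x v"

definition wedge ::
  "('x \<Rightarrow> 'x \<Rightarrow> complex^'n::finite^'n) \<Rightarrow> ('x \<Rightarrow> 'x \<Rightarrow> complex^'n^'n) \<Rightarrow>
   'x \<Rightarrow> 'x \<Rightarrow> 'x \<Rightarrow> complex^'n^'n" where
  "wedge \<theta> \<eta> x u v = \<theta> x u ** \<eta> x v - \<theta> x v ** \<eta> x u"

definition left_invariant_form ::
  "('x::real_normed_vector \<Rightarrow> ('a::{real_normed_vector,semiring_1})^'n::finite^'n) \<Rightarrow>
   'x \<Rightarrow> 'x \<Rightarrow> 'a^'n^'n" where
  "left_invariant_form F x v = matrix_inv (F x) ** ext_d F x v"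

text \<open>\<open>X\<close> is the range of coordinates of a patch of \<open>G/H\<close>: the map sending \<open>x\<close> to the coset of
  \<open>S x\<close> is injective, its image is open in \<open>G/H\<close> (the preimage in \<open>G\<close> is open in \<open>G\<close>), and its
  differential is a bijection onto the tangent space of \<open>G/H\<close>, which left translation by the
  inverse of \<open>S x\<close> identifies with the quotient of Lie algebras. In these coordinates \<open>S\<close> is a
  smooth local section of the projection from \<open>G\<close> to \<open>G/H\<close>.\<close>

definition coset_representative ::
  "(real^'n::finite^'n) set \<Rightarrow> (real^'n^'n) set \<Rightarrow> 'x::euclidean_space set \<Rightarrow>
   ('x \<Rightarrow> real^'n^'n) \<Rightarrow> bool" where
  "coset_representative G H X S \<longleftrightarrow>
     open X \<and> smooth_on S X \<and> S ` X \<subseteq> G \<and>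
     (\<forall>x\<in>X. \<forall>y\<in>X. matrix_inv (S x) ** S y \<in> H \<longrightarrow> x = y) \<and>
     openin (top_of_set G) {S x ** k |x k. x \<in> X \<and> k \<in> H} \<and>
     (\<forall>x\<in>X. \<forall>Y\<in>lie_algebra G. \<exists>!v. left_invariant_form S x v - Y \<in> lie_algebra H)"

section \<open>The complex basis\<close>

definition cayley :: "complex^('m::finite + 'm)^('m + 'm)" where
  "cayley = from_blocks (mat 1) (mat 1) (mat (- \<i>)) (mat \<i>)"

definition to_complex_basis ::
  "real^('m::finite + 'm)^('m + 'm) \<Rightarrow> complex^('m + 'm)^('m + 'm)" where
  "to_complex_basis M = matrix_inv cayley ** cmat M ** cayley"

definition U_of ::
  "('x \<Rightarrow> real^('m::finite + 'm)^('m + 'm)) \<Rightarrow> 'x \<Rightarrow> complex^('m + 'm)^('m + 'm)" where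
  "U_of S x = to_complex_basis (S x)"

definition f_of :: "('x \<Rightarrow> real^('m::finite + 'm)^('m + 'm)) \<Rightarrow> 'x \<Rightarrow> complex^'m^'m" where
  "f_of S x = cscale (1 / sqrt 2) (cmat (blockA (S x)) - cscale \<i> (cmat (blockB (S x))))"

definition h_of :: "('x \<Rightarrow> real^('m::finite + 'm)^('m + 'm)) \<Rightarrow> 'x \<Rightarrow> complex^'m^'m" where
  "h_of S x = cscale (1 / sqrt 2) (cmat (blockC (S x)) - cscale \<i> (cmat (blockD (S x))))"

definition Gamma_of ::
  "('x::real_normed_vector \<Rightarrow> real^('m::finite + 'm)^('m + 'm)) \<Rightarrow>
   'x \<Rightarrow> 'x \<Rightarrow> complex^('m + 'm)^('m + 'm)" where
  "Gamma_of S = left_invariant_form (U_of S)"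

section \<open>Connection and vielbein\<close>

text \<open>The component of \<open>Y\<close> along \<open>V\<close> in a direct sum of \<open>V\<close> and \<open>W\<close>.\<close>

definition component_along :: "'v::ab_group_add set \<Rightarrow> 'v set \<Rightarrow> 'v \<Rightarrow> 'v" where
  "component_along V W Y = (THE Z. Z \<in> V \<and> Y - Z \<in> W)"

text \<open>The component of \<open>\<Gamma>\<close> along \<open>\<hh>\<close> is diag(\<open>\<omega>\<close>, conjugate of \<open>\<omega>\<close>); the component along \<open>\<kk>\<close>
  is off-diagonal, with the vielbein in the lower left corner.\<close>

definition H_connection ::
  "(real^('m::finite + 'm)^('m + 'm)) set \<Rightarrow> (real^('m + 'm)^('m + 'm)) set \<Rightarrow>
   ('x::real_normed_vector \<Rightarrow> real^('m + 'm)^('m + 'm)) \<Rightarrow> 'x \<Rightarrow> 'x \<Rightarrow> complex^'m^'m" where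
  "H_connection \<hh> \<kk> S x v =
     blockA (component_along (to_complex_basis ` \<hh>) (to_complex_basis ` \<kk>) (Gamma_of S x v))"

definition embedded_vielbein ::
  "(real^('m::finite + 'm)^('m + 'm)) set \<Rightarrow> (real^('m + 'm)^('m + 'm)) set \<Rightarrow>
   ('x::real_normed_vector \<Rightarrow> real^('m + 'm)^('m + 'm)) \<Rightarrow> 'x \<Rightarrow> 'x \<Rightarrow> complex^'m^'m" where
  "embedded_vielbein \<hh> \<kk> S x v =
     blockC (component_along (to_complex_basis ` \<kk>) (to_complex_basis ` \<hh>) (Gamma_of S x v))"

definition nabla_mat ::
  "('x::real_normed_vector \<Rightarrow> 'x \<Rightarrow> complex^'m::finite^'m) \<Rightarrow> ('x \<Rightarrow> complex^'m^'m) \<Rightarrow>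
   'x \<Rightarrow> 'x \<Rightarrow> complex^'m^'m" where
  "nabla_mat \<omega> V x v = ext_d V x v - V x ** \<omega> x v"

definition nabla_row ::
  "('x::real_normed_vector \<Rightarrow> 'x \<Rightarrow> complex^'m::finite^'m) \<Rightarrow> ('x \<Rightarrow> complex^'m) \<Rightarrow>
   'x \<Rightarrow> 'x \<Rightarrow> complex^'m" where
  "nabla_row \<omega> V x v = ext_d V x v - V x v* \<omega> x v"

section \<open>Column labels\<close>

text \<open>The index type \<open>'m\<close> labels the rows directly. As a column index it is identified, through
  a bijection \<open>lab\<close>, with the independent labels: pairs A < B and matter indices. Objects with
  column indices are extended antisymmetrically to all pairs by \<open>component\<close> and \<open>component2\<close>.\<close>

datatype label = AutPair nat nat | Matter nat

definition independent_labels :: "nat \<Rightarrow> nat \<Rightarrow> label set" where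
  "independent_labels N n =
     {AutPair A B |A B. 1 \<le> A \<and> A < B \<and> B \<le> N} \<union> {Matter I |I. 1 \<le> I \<and> I \<le> n}"

fun is_pair :: "label \<Rightarrow> bool" where
  "is_pair (AutPair A B) = True"
| "is_pair (Matter I) = False"

fun ordered_label :: "label \<Rightarrow> label" where
  "ordered_label (AutPair A B) = AutPair (min A B) (max A B)"
| "ordered_label (Matter I) = Matter I"

fun label_sign :: "label \<Rightarrow> complex" where
  "label_sign (AutPair A B) = (if A < B then 1 else if B < A then -1 else 0)"
| "label_sign (Matter I) = 1"

definition index_of :: "('m \<Rightarrow> label) \<Rightarrow> label \<Rightarrow> 'm" where
  "index_of lab l = inv lab (ordered_label l)"

definition component :: "('m::finite \<Rightarrow> label) \<Rightarrow> complex^'m \<Rightarrow> label \<Rightarrow> complex" where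
  "component lab V l = label_sign l * V $ index_of lab l"

definition component2 :: "('m::finite \<Rightarrow> label) \<Rightarrow> complex^'m^'m \<Rightarrow> label \<Rightarrow> label \<Rightarrow> complex" where
  "component2 lab M k l = label_sign k * label_sign l * M $ index_of lab k $ index_of lab l"

definition label_block_diagonal :: "('m \<Rightarrow> label) \<Rightarrow> complex^'m::finite^'m \<Rightarrow> bool" where
  "label_block_diagonal lab w \<longleftrightarrow> (\<forall>a b. is_pair (lab a) \<noteq> is_pair (lab b) \<longrightarrow> w $ a $ b = 0)"

definition adapted_embedding ::
  "('m \<Rightarrow> label) \<Rightarrow> (real^('m::finite + 'm)^('m + 'm)) set \<Rightarrow>
   (real^('m + 'm)^('m + 'm)) set \<Rightarrow> bool" where
  "adapted_embedding lab \<hh> \<kk> \<longleftrightarrow>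
     (\<forall>X\<in>\<hh>. \<exists>w. label_block_diagonal lab w \<and> to_complex_basis X = from_blocks w 0 0 (mcnj w)) \<and>
     (\<forall>X\<in>\<kk>. \<exists>p. to_complex_basis X = from_blocks 0 (mcnj p) p 0)"

text \<open>The row vector with the independent components of the charges; \<open>component\<close> applied to it gives
  the central charges on labels \<open>AutPair A B\<close> and the matter charges on labels \<open>Matter I\<close>.\<close>

definition charges ::
  "('x \<Rightarrow> real^('m::finite + 'm)^('m + 'm)) \<Rightarrow> real^'m \<Rightarrow> real^'m \<Rightarrow> 'x \<Rightarrow> complex^'m" where
  "charges S g e x = (\<chi> c. \<Sum>\<Lambda>\<in>UNIV.
     h_of S x $ \<Lambda> $ c * complex_of_real (g $ \<Lambda>) - f_of S x $ \<Lambda> $ c * complex_of_real (e $ \<Lambda>))"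

end

theory Submission
  imports Defs
begin

text \<open>Let \<open>\<C>\<close> be the Cayley matrix. The columns of \<open>W = S \<C> / \<surd>2\<close> are (f, h) and its conjugate,
  and the symplectic relations give the inverse of \<open>S\<close>, hence that of \<open>W\<close>, linearly in \<open>S\<close>. As
  \<open>\<C>\<close> is constant, \<open>\<Gamma> = W\<^sup>-\<^sup>1 dW\<close>: its blocks are the formulas for \<open>\<Omega>\<close> and \<open>\<P>\<close>, and \<open>dW = W \<Gamma>\<close> is
  the pair of equations \<open>df = f \<Omega> + f\<^sup>* \<P>\<close>, \<open>dh = h \<Omega> + h\<^sup>* \<P>\<close>, whose contraction with the real
  charges is the equation for the charges. Flatness comes from the symmetry of second derivatives.
  Finally \<open>S\<^sup>-\<^sup>1 dS\<close> is the velocity of the curve \<open>S(x)\<^sup>-\<^sup>1 S(x + tv)\<close> in \<open>G\<close>, so it lies in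
  \<open>Lie(G) = Lie(H) + \<kk>\<close>; its block-diagonal and off-diagonal parts are its components.\<close>

section \<open>Second derivatives\<close>

lemma frechet_derivative_linear_image:
  assumes L: "bounded_linear L" and F: "F differentiable (at x)"
  shows "ext_d (\<lambda>y. L (F y)) x v = L (ext_d F x v)"
proof -
  have "((\<lambda>y. L (F y)) has_derivative (\<lambda>v. L (ext_d F x v))) (at x)"
    using bounded_linear.has_derivative[OF L] F by (simp add: frechet_derivative_works)
  then show ?thesis
    by (simp add: frechet_derivative_at[symmetric])
qed

lemma frechet_derivative_bilinear:
  assumes "bounded_bilinear b" "F differentiable (at x)" "K differentiable (at x)"
  shows "ext_d (\<lambda>y. b (F y) (K y)) x v = b (F x) (ext_d K x v) + b (ext_d F x v) (K x)"
proof -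
  have "((\<lambda>y. b (F y) (K y)) has_derivative (\<lambda>v. b (F x) (ext_d K x v) + b (ext_d F x v) (K x))) (at x)"
    using bounded_bilinear.FDERIV[OF assms(1)] assms(2,3) by (simp add: frechet_derivative_works)
  then show ?thesis
    by (simp add: frechet_derivative_at[symmetric])
qed

text \<open>\<open>frechet_derivative\<close> is a choice made from the predicate
  \<open>has_derivative\<close>, which depends only on values near the point. The predicates agree,
  hence so do the choices, even where no derivative exists.\<close>

lemma frechet_derivative_congI:
  assumes "open X" "x \<in> X" "\<And>y. y \<in> X \<Longrightarrow> F y = K y"
  shows "ext_d F x v = ext_d K x v"
proof -
  have "(F has_derivative D) (at x) \<longleftrightarrow> (K has_derivative D) (at x)" for D
    using has_derivative_transform_within_open[OF _ assms(1,2)] assms(3) by metis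
  then show ?thesis
    by (simp add: frechet_derivative_def)
qed

text \<open>Two applications of the mean value theorem: along \<open>u\<close> to the increment of
  \<open>G\<close> in direction \<open>v\<close>, then along \<open>v\<close> to the derivative
  \<open>Gu\<close>. The bound on \<open>s\<close> keeps the whole parallelogram inside
  \<open>ball x r\<close>.\<close>

lemma mixed_difference_quotient:
  fixes G :: "'a::euclidean_space \<Rightarrow> real"
  assumes X: "ball x r \<subseteq> X" "open X" and G: "Ck_on 2 G X"
    and s: "s > 0" "s * (norm u + norm v) < r"
  shows "\<exists>y. norm (y - x) \<le> s * (norm u + norm v) \<and>
    G (x + s *\<^sub>R u + s *\<^sub>R v) - G (x + s *\<^sub>R u) - G (x + s *\<^sub>R v) + G x =
      s * s * ext_d (\<lambda>z. ext_d G z u) y v"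
proof -
  define Gu where "Gu = (\<lambda>z. ext_d G z u)"
  have bound: "norm (a *\<^sub>R u + b *\<^sub>R v) \<le> s * (norm u + norm v)"
    if "0 \<le> a" "a \<le> s" "0 \<le> b" "b \<le> s" for a b
  proof -
    have "norm (a *\<^sub>R u + b *\<^sub>R v) \<le> a * norm u + b * norm v"
      by (rule norm_triangle_le) (use that in simp)
    also have "\<dots> \<le> s * norm u + s * norm v"
      using that by (intro add_mono mult_right_mono) auto
    finally show ?thesis by (simp add: algebra_simps)
  qed
  have inX: "x + a *\<^sub>R u + b *\<^sub>R v \<in> X" if "0 \<le> a" "a \<le> s" "0 \<le> b" "b \<le> s" for a b
  proof -
    have "x + a *\<^sub>R u + b *\<^sub>R v \<in> ball x r"
      using le_less_trans[OF bound[OF that] s(2)]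
        norm_minus_cancel[of "a *\<^sub>R u + b *\<^sub>R v"]
      by (simp add: dist_norm add.assoc del: norm_minus_cancel)
    then show ?thesis using X(1) by blast
  qed
  have G': "(G has_derivative ext_d G y) (at y)" "(Gu has_derivative ext_d Gu y) (at y)"
    if "y \<in> X" for y
    using G that X(2) unfolding Gu_def
    by (auto simp: numeral_2_eq_2 differentiable_on_eq_differentiable_at frechet_derivative_works)
  let ?\<phi> = "\<lambda>a. G (x + a *\<^sub>R u + s *\<^sub>R v) - G (x + a *\<^sub>R u)"
  have D1: "((\<lambda>a. G (x + a *\<^sub>R u + b *\<^sub>R v)) has_real_derivative Gu (x + a *\<^sub>R u + b *\<^sub>R v)) (at a)"
    if "0 \<le> a" "a \<le> s" "0 \<le> b" "b \<le> s" for a b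
  proof -
    have d: "(G has_derivative ext_d G (x + a *\<^sub>R u + b *\<^sub>R v)) (at (x + a *\<^sub>R u + b *\<^sub>R v))"
      using inX[OF that] by (rule G')
    have "((\<lambda>a. G (x + a *\<^sub>R u + b *\<^sub>R v)) has_derivative
        (\<lambda>t. ext_d G (x + a *\<^sub>R u + b *\<^sub>R v) (t *\<^sub>R u))) (at a)"
      by (rule has_derivative_compose[where f = "\<lambda>a. x + a *\<^sub>R u + b *\<^sub>R v", OF _ d])
        (auto intro!: derivative_eq_intros)
    then show ?thesis
      by (simp add: has_field_derivative_def Gu_def linear_cmul[OF has_derivative_linear[OF d]] mult_commute_abs)
  qed
  have D2: "((\<lambda>b. Gu (x + a *\<^sub>R u + b *\<^sub>R v)) has_real_derivative ext_d Gu (x + a *\<^sub>R u + b *\<^sub>R v) v) (at b)"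
    if "0 \<le> a" "a \<le> s" "0 \<le> b" "b \<le> s" for a b
  proof -
    have d: "(Gu has_derivative ext_d Gu (x + a *\<^sub>R u + b *\<^sub>R v)) (at (x + a *\<^sub>R u + b *\<^sub>R v))"
      using inX[OF that] by (rule G')
    have "((\<lambda>b. Gu (x + a *\<^sub>R u + b *\<^sub>R v)) has_derivative
        (\<lambda>t. ext_d Gu (x + a *\<^sub>R u + b *\<^sub>R v) (t *\<^sub>R v))) (at b)"
      by (rule has_derivative_compose[where f = "\<lambda>b. x + a *\<^sub>R u + b *\<^sub>R v", OF _ d])
        (auto intro!: derivative_eq_intros)
    then show ?thesis
      by (simp add: has_field_derivative_def linear_cmul[OF has_derivative_linear[OF d]] mult_commute_abs)
  qed
  have "\<exists>\<xi>. 0 < \<xi> \<and> \<xi> < s \<and>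
      ?\<phi> s - ?\<phi> 0 = (s - 0) * (Gu (x + \<xi> *\<^sub>R u + s *\<^sub>R v) - Gu (x + \<xi> *\<^sub>R u))"
  proof (rule MVT2[OF s(1)])
    fix a assume "0 \<le> a" "a \<le> s"
    then show "(?\<phi> has_real_derivative Gu (x + a *\<^sub>R u + s *\<^sub>R v) - Gu (x + a *\<^sub>R u)) (at a)"
      using D1[of a s] D1[of a 0] s by (auto intro!: derivative_intros)
  qed
  then obtain \<xi> where \<xi>: "0 < \<xi>" "\<xi> < s"
    "?\<phi> s - ?\<phi> 0 = s * (Gu (x + \<xi> *\<^sub>R u + s *\<^sub>R v) - Gu (x + \<xi> *\<^sub>R u))"
    by auto
  \<comment> \<open>The lower end is written with \<open>0 *\<^sub>R v\<close>, so that both ends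
    are values of the function differentiated in \<open>D2\<close>.\<close>
  have "\<exists>\<eta>. 0 < \<eta> \<and> \<eta> < s \<and>
      Gu (x + \<xi> *\<^sub>R u + s *\<^sub>R v) - Gu (x + \<xi> *\<^sub>R u + 0 *\<^sub>R v) =
        (s - 0) * ext_d Gu (x + \<xi> *\<^sub>R u + \<eta> *\<^sub>R v) v"
    by (rule MVT2[OF s(1)]) (use D2 \<xi> in auto)
  then obtain \<eta> where \<eta>: "0 < \<eta>" "\<eta> < s"
    "Gu (x + \<xi> *\<^sub>R u + s *\<^sub>R v) - Gu (x + \<xi> *\<^sub>R u) = s * ext_d Gu (x + \<xi> *\<^sub>R u + \<eta> *\<^sub>R v) v"
    by auto
  show ?thesis
    unfolding Gu_def[symmetric]
    by (rule exI[of _ "x + \<xi> *\<^sub>R u + \<eta> *\<^sub>R v"]) (use \<xi> \<eta> bound[of \<xi> \<eta>] in \<open>simp add: add.assoc\<close>)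
qed

text \<open>The difference quotient above is symmetric in \<open>u\<close> and \<open>v\<close>.\<close>

lemma mixed_derivatives_commute_real:
  fixes G :: "'a::euclidean_space \<Rightarrow> real"
  assumes X: "open X" "x \<in> X" and G: "Ck_on 2 G X"
  shows "ext_d (\<lambda>z. ext_d G z u) x v = ext_d (\<lambda>z. ext_d G z v) x u"
proof (rule ccontr)
  let ?a = "\<lambda>z. ext_d (\<lambda>z. ext_d G z u) z v" and ?b = "\<lambda>z. ext_d (\<lambda>z. ext_d G z v) z u"
  assume "?a x \<noteq> ?b x"
  \<comment> \<open>Half the gap: numbers within \<open>e\<close> of \<open>?a x\<close> and of
    \<open>?b x\<close> cannot be equal.\<close>
  define e where "e = \<bar>?a x - ?b x\<bar> / 2"
  have e: "e > 0" using \<open>?a x \<noteq> ?b x\<close> by (simp add: e_def)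
  have "isCont ?a x" "isCont ?b x"
    using G X by (auto simp: numeral_2_eq_2 continuous_on_eq_continuous_at)
  then obtain d1 d2 where d: "d1 > 0" "d2 > 0"
    "\<And>y. dist y x < d1 \<Longrightarrow> dist (?a y) (?a x) < e" "\<And>y. dist y x < d2 \<Longrightarrow> dist (?b y) (?b x) < e"
    using e unfolding continuous_at_eps_delta by metis
  obtain r where r: "r > 0" "ball x r \<subseteq> X"
    using X open_contains_ball by blast
  define \<delta> where "\<delta> = min r (min d1 d2)"
  \<comment> \<open>The summand 1 keeps the denominator positive when \<open>u\<close> and
    \<open>v\<close> vanish.\<close>
  define s where "s = \<delta> / (2 * (norm u + norm v + 1))"
  have "\<delta> > 0" using r d by (simp add: \<delta>_def)
  have n: "0 \<le> norm u" "0 \<le> norm v" by auto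
  then have s: "s > 0" "s * (norm u + norm v) < \<delta>"
  proof -
    show "s > 0" using n \<open>\<delta> > 0\<close> by (simp add: s_def add_nonneg_pos)
    then have "s * (norm u + norm v) < s * (2 * (norm u + norm v + 1))"
      using n \<open>s > 0\<close> mult_strict_left_mono[of "norm u + norm v" "2 * (norm u + norm v + 1)" s]
      by (smt (verit))
    also have "\<dots> = \<delta>" using n by (simp add: s_def add_nonneg_eq_0_iff)
    finally show "s * (norm u + norm v) < \<delta>" .
  qed
  then have sr: "s * (norm u + norm v) < r" "s * (norm v + norm u) < r"
    by (simp_all add: \<delta>_def add.commute)
  obtain y where y: "norm (y - x) \<le> s * (norm u + norm v)"
    "G (x + s *\<^sub>R u + s *\<^sub>R v) - G (x + s *\<^sub>R u) - G (x + s *\<^sub>R v) + G x = s * s * ?a y"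
    using mixed_difference_quotient[OF r(2) X(1) G s(1) sr(1)] by blast
  obtain z where z: "norm (z - x) \<le> s * (norm v + norm u)"
    "G (x + s *\<^sub>R v + s *\<^sub>R u) - G (x + s *\<^sub>R v) - G (x + s *\<^sub>R u) + G x = s * s * ?b z"
    using mixed_difference_quotient[OF r(2) X(1) G s(1) sr(2)] by blast
  \<comment> \<open>Exchanging \<open>u\<close> and \<open>v\<close> leaves the numerator unchanged,
    so the two mixed derivatives agree at possibly different points \<open>y\<close> and
    \<open>z\<close> near \<open>x\<close>.\<close>
  have "x + s *\<^sub>R v + s *\<^sub>R u = x + s *\<^sub>R u + s *\<^sub>R v" by simp
  then have "s * s * ?a y = s * s * ?b z"
    using y(2) z(2) by (smt (verit))
  then have "?a y = ?b z" using s(1) by simp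
  moreover have "dist (?a y) (?a x) < e" "dist (?b z) (?b x) < e"
    using y(1) z(1) s d(3)[of y] d(4)[of z] by (simp_all add: dist_norm \<delta>_def add.commute)
  ultimately show False
    unfolding e_def dist_real_def by argo
qed

section \<open>Smooth maps composed with linear maps\<close>

lemma Ck_on_cong:
  assumes "open X" "\<And>y. y \<in> X \<Longrightarrow> F y = K y" "Ck_on k F X"
  shows "Ck_on k K X"
  using assms(2,3)
proof (induction k arbitrary: F K)
  case 0
  then show ?case by (simp cong: continuous_on_cong)
next
  case (Suc k)
  have "K differentiable_on X"
  proof -
    have "(K has_derivative ext_d F x) (at x)" if "x \<in> X" for x
    proof (rule has_derivative_transform_within_open[OF _ assms(1) that])
      show "(F has_derivative ext_d F x) (at x)"
        using Suc.prems(2) that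
        by (simp add: differentiable_on_eq_differentiable_at[OF assms(1)] frechet_derivative_works)
    qed (simp add: Suc.prems(1))
    then show ?thesis
      unfolding differentiable_on_eq_differentiable_at[OF assms(1)] differentiable_def by blast
  qed
  moreover have "Ck_on k (\<lambda>x. ext_d K x v) X" for v
  proof (rule Suc.IH)
    show "Ck_on k (\<lambda>x. ext_d F x v) X" using Suc.prems(2) by simp
    show "ext_d F y v = ext_d K y v" if "y \<in> X" for y
      using frechet_derivative_congI[OF assms(1) that] Suc.prems(1) by blast
  qed
  ultimately show ?case by simp
qed

text \<open>The derivative of the composite along \<open>w\<close> has the same shape, with
  \<open>F\<close> replaced by its derivative along the fixed vector \<open>T w\<close>; the
  induction therefore runs over all \<open>F\<close>. It serves for the coordinates of a map and for
  its restriction to a line.\<close>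

lemma Ck_on_linear_compose:
  fixes F :: "'a::euclidean_space \<Rightarrow> 'b::real_normed_vector"
    and T :: "'c::euclidean_space \<Rightarrow> 'a"
  assumes L: "bounded_linear L" and T: "bounded_linear T"
    and XY: "open X" "open Y" "\<And>t. t \<in> Y \<Longrightarrow> a + T t \<in> X" and F: "Ck_on k F X"
  shows "Ck_on k (\<lambda>t. L (F (a + T t))) Y"
  using F
proof (induction k arbitrary: F)
  case 0
  have "continuous_on Y (\<lambda>t. F (a + T t))"
    by (rule continuous_on_compose2[of X F])
      (use 0 XY in \<open>auto intro!: continuous_on_add continuous_on_const linear_continuous_on[OF T]\<close>)
  then show ?case
    using bounded_linear.continuous_on[OF L] by simp
next
  case (Suc k)
  have D: "((\<lambda>t. L (F (a + T t))) has_derivative (\<lambda>w. L (ext_d F (a + T t) (T w)))) (at t)"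
    if "t \<in> Y" for t
  proof -
    have "(F has_derivative ext_d F (a + T t)) (at (a + T t))"
      using Suc.prems XY that
      by (auto simp: differentiable_on_eq_differentiable_at frechet_derivative_works)
    then have "((\<lambda>t. F (a + T t)) has_derivative (\<lambda>w. ext_d F (a + T t) (T w))) (at t)"
      by (rule has_derivative_compose[rotated])
        (auto intro!: derivative_eq_intros bounded_linear_imp_has_derivative T)
    then show ?thesis by (rule bounded_linear.has_derivative[OF L])
  qed
  then have "(\<lambda>t. L (F (a + T t))) differentiable_on Y"
    by (auto simp: differentiable_on_eq_differentiable_at[OF XY(2)] differentiable_def)
  moreover have "Ck_on k (\<lambda>t. ext_d (\<lambda>t. L (F (a + T t))) t w) Y" for w
  proof (rule Ck_on_cong[OF XY(2)])
    show "Ck_on k (\<lambda>t. L (ext_d F (a + T t) (T w))) Y"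
      using Suc.prems by (intro Suc.IH) simp
  qed (simp add: frechet_derivative_at[OF D, symmetric])
  ultimately show ?case by simp
qed

text \<open>The inner product with a basis vector is bounded linear, so it commutes with both
  differentiations and reduces the claim to real-valued maps.\<close>

lemma mixed_derivatives_commute:
  fixes F :: "'a::euclidean_space \<Rightarrow> 'b::euclidean_space"
  assumes X: "open X" "x \<in> X" and F: "Ck_on 2 F X"
  shows "ext_d (\<lambda>z. ext_d F z u) x v = ext_d (\<lambda>z. ext_d F z v) x u"
proof (rule euclidean_eqI)
  fix b :: 'b
  have bl: "bounded_linear (\<lambda>z. z \<bullet> b)" by (rule bounded_linear_inner_left)
  have "Ck_on 2 (\<lambda>z. F z \<bullet> b) X"
    using Ck_on_linear_compose[OF bl bounded_linear_ident X(1) X(1) _ F, of 0] by simp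
  note comm = mixed_derivatives_commute_real[OF X this, of u v]
  have D: "F differentiable (at z)" "(\<lambda>z. ext_d F z w) differentiable (at z)" if "z \<in> X" for z w
    using F that by (auto simp: numeral_2_eq_2 differentiable_on_eq_differentiable_at[OF X(1)])
  have "ext_d (\<lambda>z. ext_d (\<lambda>z. F z \<bullet> b) z p) x q = ext_d (\<lambda>z. ext_d F z p) x q \<bullet> b" for p q
  proof -
    \<comment> \<open>The inner derivative is replaced at every point of \<open>X\<close>, because
      the outer one sees a neighbourhood of \<open>x\<close>.\<close>
    have "ext_d (\<lambda>z. ext_d (\<lambda>z. F z \<bullet> b) z p) x q = ext_d (\<lambda>z. ext_d F z p \<bullet> b) x q"
      by (rule frechet_derivative_congI[OF X]) (rule frechet_derivative_linear_image[OF bl D(1)])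
    also have "\<dots> = ext_d (\<lambda>z. ext_d F z p) x q \<bullet> b"
      by (rule frechet_derivative_linear_image[OF bl D(2)[OF X(2)]])
    finally show ?thesis .
  qed
  with comm show "ext_d (\<lambda>z. ext_d F z u) x v \<bullet> b = ext_d (\<lambda>z. ext_d F z v) x u \<bullet> b" by simp
qed

section \<open>The complex basis\<close>

lemmas block_defs = blockA_def blockB_def blockC_def blockD_def

lemma from_blocks_nth [simp]:
  "from_blocks A B C D $ Inl a $ Inl b = A $ a $ b"
  "from_blocks A B C D $ Inl a $ Inr b = B $ a $ b"
  "from_blocks A B C D $ Inr a $ Inl b = C $ a $ b"
  "from_blocks A B C D $ Inr a $ Inr b = D $ a $ b"
  by (simp_all add: from_blocks_def)

lemma block_nth [simp]:
  "blockA M $ a $ b = M $ Inl a $ Inl b" "blockB M $ a $ b = M $ Inl a $ Inr b"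
  "blockC M $ a $ b = M $ Inr a $ Inl b" "blockD M $ a $ b = M $ Inr a $ Inr b"
  by (simp_all add: block_defs)

lemma matrix_eqI: "(\<And>i j. M $ i $ j = N $ i $ j) \<Longrightarrow> M = N"
  by (simp add: vec_eq_iff)

lemma block_eqI:
  fixes M N :: "'a^('m::finite + 'm)^('m + 'm)"
  assumes "blockA M = blockA N" "blockB M = blockB N" "blockC M = blockC N" "blockD M = blockD N"
  shows "M = N"
proof (rule matrix_eqI)
  fix i j :: "'m + 'm"
  show "M $ i $ j = N $ i $ j"
    using assms by (cases i; cases j) (auto simp: block_defs vec_eq_iff)
qed

lemma block_from_blocks [simp]:
  "blockA (from_blocks A B C D) = A" "blockB (from_blocks A B C D) = B"
  "blockC (from_blocks A B C D) = C" "blockD (from_blocks A B C D) = D"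
  by (simp_all add: vec_eq_iff)

lemma sum_UNIV_Plus: "(\<Sum>k\<in>UNIV. g k) = (\<Sum>a\<in>UNIV. g (Inl a)) + (\<Sum>b\<in>UNIV. g (Inr b))"
  for g :: "'m::finite + 'm \<Rightarrow> 'b::comm_monoid_add"
  by (simp add: UNIV_Plus_UNIV[symmetric] sum.Plus del: UNIV_Plus_UNIV)

lemma block_matrix_mult:
  fixes M N :: "'a::semiring_1^('m::finite + 'm)^('m + 'm)"
  shows "blockA (M ** N) = blockA M ** blockA N + blockB M ** blockC N"
    and "blockB (M ** N) = blockA M ** blockB N + blockB M ** blockD N"
    and "blockC (M ** N) = blockC M ** blockA N + blockD M ** blockC N"
    and "blockD (M ** N) = blockC M ** blockB N + blockD M ** blockD N"
  by (simp_all add: vec_eq_iff matrix_matrix_mult_def sum_UNIV_Plus)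

lemma block_mat [simp]:
  "blockA (mat c) = mat c" "blockB (mat c) = 0" "blockC (mat c) = 0" "blockD (mat c) = mat c"
  by (simp_all add: vec_eq_iff mat_def)

lemma block_cmat:
  "blockA (cmat M) = cmat (blockA M)" "blockB (cmat M) = cmat (blockB M)"
  "blockC (cmat M) = cmat (blockC M)" "blockD (cmat M) = cmat (blockD M)"
  by (simp_all add: vec_eq_iff cmat_def)

lemma block_cscale:
  "blockA (cscale c M) = cscale c (blockA M)" "blockB (cscale c M) = cscale c (blockB M)"
  "blockC (cscale c M) = cscale c (blockC M)" "blockD (cscale c M) = cscale c (blockD M)"
  by (simp_all add: vec_eq_iff cscale_def)

lemma cscale_nth [simp]: "cscale c M $ i $ j = c * M $ i $ j"
  by (simp add: cscale_def)

lemma mcnj_nth [simp]: "mcnj M $ i $ j = cnj (M $ i $ j)"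
  by (simp add: mcnj_def)

lemma dagger_nth [simp]: "dagger M $ i $ j = cnj (M $ j $ i)"
  by (simp add: dagger_def transpose_def)

lemma cmat_nth [simp]: "cmat M $ i $ j = complex_of_real (M $ i $ j)"
  by (simp add: cmat_def)

lemma cmat_mult: "cmat (M ** N) = cmat M ** cmat N"
  by (simp add: vec_eq_iff matrix_matrix_mult_def)

lemma cmat_mat: "cmat (mat c) = mat (complex_of_real c)"
  by (simp add: vec_eq_iff mat_def)

lemma cscale_mult: "cscale c M ** N = cscale c (M ** N)" "M ** cscale c N = cscale c (M ** N)"
  by (simp_all add: vec_eq_iff matrix_matrix_mult_def sum_distrib_left mult_ac)

lemma cscale_cscale: "cscale c (cscale d M) = cscale (c * d) M"
  by (simp add: vec_eq_iff mult_ac)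

lemma cscale_one: "cscale 1 M = M"
  by (simp add: vec_eq_iff)

lemma matrix_mult_mat_nth:
  fixes M :: "'a::semiring_1^'n::finite^'n"
  shows "(M ** mat c) $ i $ j = M $ i $ j * c" "(mat c ** M) $ i $ j = c * M $ i $ j"
  by (simp_all add: matrix_matrix_mult_def mat_def if_distrib if_distribR sum.If_cases cong: if_cong)

lemma bounded_bilinear_matrix_mult:
  "bounded_bilinear ((**) :: real^'n::finite^'n \<Rightarrow> real^'n^'n \<Rightarrow> real^'n^'n)"
  by (subst bilinear_conv_bounded_bilinear[symmetric])
    (simp add: bilinear_def linear_iff vec_eq_iff matrix_matrix_mult_def
      algebra_simps sum.distrib sum_distrib_left)

section \<open>Conjugation by the Cayley matrix\<close>

definition cayley_inv :: "complex^('m::finite + 'm)^('m + 'm)" where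
  "cayley_inv = from_blocks (mat (1/2)) (mat (\<i>/2)) (mat (1/2)) (mat (- \<i>/2))"

lemma cayley_inv: "cayley_inv ** cayley = mat 1" "cayley ** cayley_inv = mat 1"
proof -
  show "cayley_inv ** cayley = (mat 1 :: complex^('m::finite + 'm)^('m + 'm))"
    by (rule block_eqI) (auto simp: block_matrix_mult cayley_inv_def cayley_def vec_eq_iff
        matrix_mult_mat_nth, simp_all add: mat_def)
  then show "cayley ** cayley_inv = (mat 1 :: complex^('m::finite + 'm)^('m + 'm))"
    by (simp add: matrix_left_right_inverse)
qed

text \<open>\<open>matrix_inv\<close> chooses a two-sided inverse, and over a field a left inverse
  of a square matrix is one.\<close>

lemma matrix_inv_eqI:
  fixes M :: "'a::field^'n::finite^'n"
  assumes "N ** M = mat 1"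
  shows "matrix_inv M = N"
proof -
  have "invertible M" using assms invertible_left_inverse by blast
  then have "M ** matrix_inv M = mat 1" by (auto simp: invertible_def matrix_inv_def intro: someI2_ex)
  then have "N = N ** (M ** matrix_inv M)" by simp
  then show ?thesis by (simp add: matrix_mul_assoc assms)
qed

lemma to_complex_basis_eq: "to_complex_basis M = cayley_inv ** cmat M ** cayley"
  unfolding to_complex_basis_def by (simp add: matrix_inv_eqI[OF cayley_inv(1)])

lemma to_complex_basis_mult: "to_complex_basis (M ** N) = to_complex_basis M ** to_complex_basis N"
proof -
  have "to_complex_basis M ** to_complex_basis N =
      cayley_inv ** cmat M ** (cayley ** cayley_inv) ** cmat N ** cayley"
    unfolding to_complex_basis_eq by (simp only: matrix_mul_assoc)
  then show ?thesis by (simp add: cayley_inv to_complex_basis_eq cmat_mult matrix_mul_assoc)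
qed

lemma to_complex_basis_one: "to_complex_basis (mat 1) = mat 1"
  by (simp add: to_complex_basis_eq cmat_mat cayley_inv)

lemma linear_to_complex_basis: "linear to_complex_basis"
  by (rule linearI)
    (simp_all add: to_complex_basis_eq vec_eq_iff matrix_matrix_mult_def algebra_simps
      sum.distrib sum_distrib_left scaleR_conv_of_real[where 'a = complex])

text \<open>Conjugating back recovers \<open>cmat M\<close>, whose entries determine
  \<open>M\<close>. Injectivity keeps the Cartan decomposition direct in the complex basis.\<close>

lemma inj_to_complex_basis: "inj to_complex_basis"
proof (rule injI)
  fix M N :: "real^('m::finite + 'm)^('m + 'm)"
  assume "to_complex_basis M = to_complex_basis N"
  moreover have "cayley ** to_complex_basis K ** cayley_inv = cmat K"
    for K :: "real^('m + 'm)^('m + 'm)"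
  proof -
    have "cayley ** to_complex_basis K ** cayley_inv =
        (cayley ** cayley_inv) ** cmat K ** (cayley ** cayley_inv)"
      unfolding to_complex_basis_eq by (simp only: matrix_mul_assoc)
    then show ?thesis by (simp add: cayley_inv)
  qed
  ultimately have "cmat M = cmat N" by metis
  then show "M = N" by (simp add: vec_eq_iff)
qed

section \<open>Inverses of symplectic matrices\<close>

definition symplectic_inv :: "real^('m::finite + 'm)^('m + 'm) \<Rightarrow> real^('m + 'm)^('m + 'm)" where
  "symplectic_inv M = from_blocks (transpose (blockD M)) (- transpose (blockB M))
     (- transpose (blockC M)) (transpose (blockA M))"

lemma matrix_mult_minus_left: "(- M) ** N = - (M ** N)" for M N :: "'a::ring_1^'n::finite^'n"
  by (simp add: vec_eq_iff matrix_matrix_mult_def sum_negf)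

text \<open>\<open>symplectic_inv M\<close> is J^(-1) M^t J for the block matrix J = (0, 1; -1, 0).
  The blocks of its product with \<open>M\<close> are the symplectic relations.\<close>

lemma symplectic_inv:
  assumes "M \<in> symplectic_group"
  shows "symplectic_inv M ** M = mat 1" "M ** symplectic_inv M = mat 1"
    "matrix_inv M = symplectic_inv M"
proof -
  have eqs: "transpose (blockA M) ** blockC M = transpose (blockC M) ** blockA M"
    "transpose (blockB M) ** blockD M = transpose (blockD M) ** blockB M"
    "transpose (blockA M) ** blockD M - transpose (blockC M) ** blockB M = mat 1"
    using assms by (auto simp: symplectic_group_def)
  \<comment> \<open>Transposing the third relation gives the upper left block of the
    product.\<close>
  have "transpose (transpose (blockA M) ** blockD M - transpose (blockC M) ** blockB M) = transpose (mat 1)"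
    using eqs(3) by simp
  then have eq4: "transpose (blockD M) ** blockA M - transpose (blockB M) ** blockC M = mat 1"
    by (simp add: transpose_mat) (simp add: transpose_def vec_eq_iff matrix_matrix_mult_def mult.commute)
  show *: "symplectic_inv M ** M = mat 1"
    by (rule block_eqI)
      (use eqs eq4 in \<open>simp_all add: block_matrix_mult symplectic_inv_def matrix_mult_minus_left\<close>)
  then show "M ** symplectic_inv M = mat 1" "matrix_inv M = symplectic_inv M"
    by (simp_all add: matrix_left_right_inverse matrix_inv_eqI)
qed

lemma linear_symplectic_inv: "linear symplectic_inv"
  by (rule linearI; rule block_eqI) (simp_all add: symplectic_inv_def vec_eq_iff transpose_def)

lemma left_inverse_to_complex_basis:
  assumes "M \<in> symplectic_group"
  shows "matrix_inv (to_complex_basis M) ** to_complex_basis N = to_complex_basis (symplectic_inv M ** N)"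
proof -
  have "matrix_inv (to_complex_basis M) = to_complex_basis (symplectic_inv M)"
    by (rule matrix_inv_eqI)
      (simp add: to_complex_basis_mult[symmetric] symplectic_inv(1)[OF assms] to_complex_basis_one)
  then show ?thesis by (simp add: to_complex_basis_mult)
qed

section \<open>The matrices \<open>f\<close>, \<open>h\<close> and the structure equations\<close>

abbreviation f_mat :: "real^('m::finite + 'm)^('m + 'm) \<Rightarrow> complex^'m^'m" where
  "f_mat \<equiv> f_of id"

abbreviation h_mat :: "real^('m::finite + 'm)^('m + 'm) \<Rightarrow> complex^'m^'m" where
  "h_mat \<equiv> h_of id"

lemma f_of_eq: "f_of S x = f_mat (S x)" and h_of_eq: "h_of S x = h_mat (S x)"
  by (simp_all add: f_of_def h_of_def)

text \<open>With \<open>id\<close> in place of \<open>S\<close>, \<open>f\<close> and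
  \<open>h\<close> become real-linear functions of the matrix alone; their differentials are the
  same functions applied to \<open>ext_d S x v\<close>.\<close>

lemma linear_f_mat: "linear f_mat" and linear_h_mat: "linear h_mat"
  by (rule linearI; simp add: f_of_def h_of_def vec_eq_iff algebra_simps scaleR_conv_of_real[where 'a = complex])+

text \<open>\<open>to_complex_basis M\<close> is sqrt 2 times \<open>cayley_inv ** W_mat M\<close>.
  The two differ by a constant left factor, which drops out of the left-invariant form.\<close>

definition W_mat :: "real^('m::finite + 'm)^('m + 'm) \<Rightarrow> complex^('m + 'm)^('m + 'm)" where
  "W_mat M = from_blocks (f_mat M) (mcnj (f_mat M)) (h_mat M) (mcnj (h_mat M))"

text \<open>On the symplectic group, the inverse of \<open>W_mat M\<close>.\<close>

definition W_dual :: "real^('m::finite + 'm)^('m + 'm) \<Rightarrow> complex^('m + 'm)^('m + 'm)" where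
  "W_dual M = cscale \<i> (from_blocks (- dagger (h_mat M)) (dagger (f_mat M))
     (transpose (h_mat M)) (- transpose (f_mat M)))"

lemma W_mat_eq: "W_mat M = cscale (1 / sqrt 2) (cmat M ** cayley)"
  by (rule block_eqI)
    (auto simp: W_mat_def f_of_def h_of_def block_cscale block_matrix_mult block_cmat cayley_def
      vec_eq_iff matrix_mult_mat_nth field_simps)

lemma W_dual_eq: "W_dual M = cscale (sqrt 2) (cayley_inv ** cmat (symplectic_inv M))"
proof -
  \<comment> \<open>The entries of \<open>f\<close> and \<open>h\<close> carry 1 / sqrt 2, the other
    side carries sqrt 2 times the halves of \<open>cayley_inv\<close>.\<close>
  have r: "z / complex_of_real (sqrt 2) = complex_of_real (sqrt 2) * (z / 2)" for z
  proof -
    have "complex_of_real (sqrt 2) * complex_of_real (sqrt 2) = 2"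
      by (simp flip: of_real_mult)
    then show ?thesis by (simp add: field_simps)
  qed
  show ?thesis
    by (rule block_eqI)
      (auto simp: W_dual_def f_of_def h_of_def block_cscale block_matrix_mult block_cmat cayley_inv_def
        symplectic_inv_def transpose_def vec_eq_iff matrix_mult_mat_nth r algebra_simps)
qed

text \<open>The scalars sqrt 2 and 1 / sqrt 2 cancel. For \<open>M = S x\<close> and
  \<open>N = ext_d S x v\<close> this matrix is \<Gamma>.\<close>

lemma W_dual_mult_W_mat: "W_dual M ** W_mat N = to_complex_basis (symplectic_inv M ** N)"
  by (simp add: W_dual_eq W_mat_eq cscale_mult cscale_cscale cscale_one cmat_mult matrix_mul_assoc
      to_complex_basis_eq)

lemma W_mat_mult_W_dual:
  assumes "M \<in> symplectic_group"
  shows "W_mat M ** W_dual M = mat 1"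
proof -
  have "W_mat M ** W_dual M = cmat M ** (cayley ** cayley_inv) ** cmat (symplectic_inv M)"
    by (simp add: W_dual_eq W_mat_eq cscale_mult cscale_cscale cscale_one matrix_mul_assoc)
  then show ?thesis
    by (simp add: cayley_inv symplectic_inv(2)[OF assms] cmat_mat flip: cmat_mult)
qed

text \<open>The second argument will be a tangent matrix; leaving it free, here and in
  \<open>P_mat\<close>, separates the algebra from the calculus.\<close>

definition Omega_mat where
  "Omega_mat M N = cscale \<i> (dagger (f_mat M) ** h_mat N - dagger (h_mat M) ** f_mat N)"

definition P_mat where
  "P_mat M N = cscale (- \<i>) (transpose (f_mat M) ** h_mat N - transpose (h_mat M) ** f_mat N)"

text \<open>These are the blocks of \<open>W_dual M ** W_mat N\<close>; the right column is the
  conjugate of the left one with its rows exchanged.\<close>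

lemma to_complex_basis_blocks:
  "to_complex_basis (symplectic_inv M ** N) =
     from_blocks (Omega_mat M N) (mcnj (P_mat M N)) (P_mat M N) (mcnj (Omega_mat M N))"
  unfolding W_dual_mult_W_mat[symmetric]
  by (rule block_eqI)
    (auto simp: W_dual_def W_mat_def Omega_mat_def P_mat_def block_cscale block_matrix_mult cscale_mult
      vec_eq_iff,
      simp_all add: matrix_matrix_mult_def transpose_def sum_distrib_left sum_negf sum_subtractf
        algebra_simps)

text \<open>Multiplying \<open>W_dual M ** W_mat N\<close> on the left by \<open>W_mat M\<close>
  restores \<open>W_mat N\<close>; the two equations are the left block column of this
  identity.\<close>

lemma structure_equations:
  assumes "M \<in> symplectic_group"
  shows "f_mat N = f_mat M ** Omega_mat M N + mcnj (f_mat M) ** P_mat M N"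
    and "h_mat N = h_mat M ** Omega_mat M N + mcnj (h_mat M) ** P_mat M N"
proof -
  have "W_mat N = W_mat M ** to_complex_basis (symplectic_inv M ** N)"
    by (simp add: W_dual_mult_W_mat[symmetric] matrix_mul_assoc W_mat_mult_W_dual[OF assms])
  then have "blockA (W_mat N) = blockA (W_mat M ** to_complex_basis (symplectic_inv M ** N))"
    "blockC (W_mat N) = blockC (W_mat M ** to_complex_basis (symplectic_inv M ** N))"
    by simp_all
  then show "f_mat N = f_mat M ** Omega_mat M N + mcnj (f_mat M) ** P_mat M N"
    "h_mat N = h_mat M ** Omega_mat M N + mcnj (h_mat M) ** P_mat M N"
    by (simp_all add: W_mat_def to_complex_basis_blocks block_matrix_mult)
qed

lemma U_of_blocks:
  "U_of S x = cscale (1 / sqrt 2) (from_blocks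
     (f_of S x + cscale \<i> (h_of S x)) (mcnj (f_of S x) + cscale \<i> (mcnj (h_of S x)))
     (f_of S x - cscale \<i> (h_of S x)) (mcnj (f_of S x) - cscale \<i> (mcnj (h_of S x))))"
proof -
  have r: "complex_of_real (sqrt 2) * complex_of_real (sqrt 2) = 2"
    by (simp flip: of_real_mult)
  have "U_of S x = cayley_inv ** cscale (sqrt 2) (W_mat (S x))"
    by (simp add: U_of_def to_complex_basis_eq W_mat_eq cscale_mult cscale_cscale cscale_one matrix_mul_assoc)
  \<comment> \<open>The factor sqrt 2 is split as (1 / sqrt 2) * 2, and the 2 cancels the halves in
    \<open>cayley_inv\<close>.\<close>
  also have "\<dots> = cscale (1 / sqrt 2) (cscale 2 (cayley_inv ** W_mat (S x)))"
    by (simp add: cscale_mult cscale_cscale r[symmetric])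
  also have "cscale 2 (cayley_inv ** W_mat (S x)) = from_blocks
     (f_of S x + cscale \<i> (h_of S x)) (mcnj (f_of S x) + cscale \<i> (mcnj (h_of S x)))
     (f_of S x - cscale \<i> (h_of S x)) (mcnj (f_of S x) - cscale \<i> (mcnj (h_of S x)))"
    by (rule block_eqI) (auto simp: block_cscale block_matrix_mult cayley_inv_def W_mat_def
      f_of_eq[of S] h_of_eq[of S] vec_eq_iff matrix_mult_mat_nth algebra_simps)
  finally show ?thesis .
qed

section \<open>The left-invariant form\<close>

lemma bounded_linearI_linear: "linear L \<Longrightarrow> bounded_linear L"
  for L :: "'a::euclidean_space \<Rightarrow> 'b::real_normed_vector"
  by (rule linear_conv_bounded_linear[THEN iffD1])

lemma smooth_on_differentiable:
  assumes "smooth_on F X" "open X" "x \<in> X"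
  shows "F differentiable (at x)" "(\<lambda>y. ext_d F y v) differentiable (at x)"
proof -
  have "Ck_on 2 F X" using assms(1) by (simp add: smooth_on_def)
  then show "F differentiable (at x)" "(\<lambda>y. ext_d F y v) differentiable (at x)"
    using assms(2,3) by (auto simp: numeral_2_eq_2 differentiable_on_eq_differentiable_at)
qed

lemma left_invariant_form_in_lie_algebra:
  fixes S :: "'x::euclidean_space \<Rightarrow> real^'n::finite^'n"
  assumes G: "matrix_lie_group G" and X: "open X" "x \<in> X" and S: "smooth_on S X" "S ` X \<subseteq> G"
  shows "left_invariant_form S x v \<in> lie_algebra G"
proof -
  define L where "L = (\<lambda>M :: real^'n^'n. matrix_inv (S x) ** M)"
  have L: "bounded_linear L"
    unfolding L_def by (rule bounded_bilinear.bounded_linear_right[OF bounded_bilinear_matrix_mult])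
  define \<gamma> where "\<gamma> = (\<lambda>t::real. L (S (x + t *\<^sub>R v)))"
  have Sx: "S x \<in> G" "invertible (S x)" "matrix_inv (S x) \<in> G"
    using G X S by (auto simp: matrix_lie_group_def)
  have "isCont (\<lambda>t::real. x + t *\<^sub>R v) 0" by (intro continuous_intros)
  then have "\<forall>\<^sub>F t in at 0. x + t *\<^sub>R v \<in> X"
    using X by (auto simp: isCont_def intro: topological_tendstoD)
  then obtain \<epsilon> where \<epsilon>: "\<epsilon> > 0" "\<And>t. t \<noteq> 0 \<Longrightarrow> dist t 0 < \<epsilon> \<Longrightarrow> x + t *\<^sub>R v \<in> X"
    unfolding eventually_at by auto
  \<comment> \<open>The filter \<open>at 0\<close> leaves out t = 0, where the point is
    \<open>x\<close> itself.\<close>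
  have inX: "x + t *\<^sub>R v \<in> X" if "t \<in> {-\<epsilon><..<\<epsilon>}" for t
    using \<epsilon>(2)[of t] X(2) that by (cases "t = 0") (auto simp: abs_less_iff)
  \<comment> \<open>The curve is the line \<open>x + t *\<^sub>R v\<close> followed by
    \<open>S\<close> and by the linear left translation \<open>L\<close>.\<close>
  have "smooth_on \<gamma> {-\<epsilon><..<\<epsilon>}"
    unfolding smooth_on_def \<gamma>_def
    by (intro allI Ck_on_linear_compose[OF L bounded_linear_scaleR_left X(1) _ inX])
      (use S(1) in \<open>auto simp: smooth_on_def\<close>)
  moreover have "\<gamma> ` {-\<epsilon><..<\<epsilon>} \<subseteq> G"
  proof (rule image_subsetI)
    fix t assume "t \<in> {-\<epsilon><..<\<epsilon>}"
    then have "S (x + t *\<^sub>R v) \<in> G" using inX S(2) by blast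
    then show "\<gamma> t \<in> G" using Sx(3) G by (simp add: matrix_lie_group_def \<gamma>_def L_def)
  qed
  moreover have "\<gamma> 0 = mat 1"
  proof -
    obtain B where "S x ** B = mat 1" "B ** S x = mat 1"
      using Sx(2) by (auto simp: invertible_def)
    then show ?thesis by (simp add: \<gamma>_def L_def matrix_inv_eqI)
  qed
  moreover have "(\<gamma> has_vector_derivative left_invariant_form S x v) (at 0)"
  proof -
    have d: "(S has_derivative ext_d S x) (at (x + 0 *\<^sub>R v))"
      using smooth_on_differentiable(1)[OF S(1) X] by (simp add: frechet_derivative_works)
    have "((\<lambda>t. S (x + t *\<^sub>R v)) has_derivative (\<lambda>t. ext_d S x (t *\<^sub>R v))) (at 0)"
      by (rule has_derivative_compose[where f = "\<lambda>t. x + t *\<^sub>R v", OF _ d])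
        (auto intro!: derivative_eq_intros)
    then have "(\<gamma> has_derivative (\<lambda>t. L (ext_d S x (t *\<^sub>R v)))) (at 0)"
      unfolding \<gamma>_def by (rule bounded_linear.has_derivative[OF L])
    then show ?thesis
      by (simp add: has_vector_derivative_def left_invariant_form_def L_def[symmetric]
          linear_cmul[OF has_derivative_linear[OF d]] linear_cmul[OF bounded_linear.linear[OF L]])
  qed
  ultimately show ?thesis
    using \<epsilon>(1) unfolding lie_algebra_def curve_in_group_def by blast
qed

section \<open>Components along the Cartan decomposition\<close>

lemma component_along_eqI:
  fixes V W :: "'v::real_vector set"
  assumes "subspace V" "subspace W" "V \<inter> W = {0}" "a \<in> V" "b \<in> W"
  shows "component_along V W (a + b) = a"
  unfolding component_along_def
proof (rule the_equality)
  fix Z assume Z: "Z \<in> V \<and> a + b - Z \<in> W"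
  \<comment> \<open>Two candidates differ by an element of \<open>V \<inter> W\<close>, which gives
    the uniqueness demanded by \<open>THE\<close>.\<close>
  have "a - Z \<in> V"
    using Z assms by (blast intro: subspace_diff)
  moreover have "(a + b - Z) - b \<in> W"
    using Z assms by (blast intro: subspace_diff)
  ultimately have "a - Z \<in> V \<inter> W" by (simp add: algebra_simps)
  then show "Z = a" using assms(3) by simp
qed (use assms in simp)

text \<open>The part of \<open>Y\<close> in \<open>\<hh>\<close> is block diagonal and the part in
  \<open>\<kk>\<close> block off-diagonal, so comparing blocks identifies both parts.\<close>

lemma components_of_adapted_form:
  assumes c: "cartan_decomposition \<gg> \<hh> \<kk>" and a: "adapted_embedding lab \<hh> \<kk>"
    and Y: "Y \<in> \<gg>" "to_complex_basis Y = from_blocks \<Omega> Q P R"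
  shows "blockA (component_along (to_complex_basis ` \<hh>) (to_complex_basis ` \<kk>) (to_complex_basis Y)) = \<Omega>"
    and "blockC (component_along (to_complex_basis ` \<kk>) (to_complex_basis ` \<hh>) (to_complex_basis Y)) = P"
proof -
  let ?c = to_complex_basis
  obtain Y1 Y2 where Y12: "Y = Y1 + Y2" "Y1 \<in> \<hh>" "Y2 \<in> \<kk>"
    using c Y(1) unfolding cartan_decomposition_def by blast
  have sub: "subspace (?c ` \<hh>)" "subspace (?c ` \<kk>)"
    using c unfolding cartan_decomposition_def
    by (blast intro: linear_subspace_image[OF linear_to_complex_basis])+
  have "?c ` \<hh> \<inter> ?c ` \<kk> = ?c ` {0}"
    using c unfolding cartan_decomposition_def image_Int[OF inj_to_complex_basis, symmetric]
    by (elim conjE) (rule arg_cong)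
  then have int: "?c ` \<hh> \<inter> ?c ` \<kk> = {0}" "?c ` \<kk> \<inter> ?c ` \<hh> = {0}"
    by (auto simp: linear_0[OF linear_to_complex_basis])
  obtain w p where wp: "?c Y1 = from_blocks w 0 0 (mcnj w)" "?c Y2 = from_blocks 0 (mcnj p) p 0"
    using a Y12 unfolding adapted_embedding_def by blast
  have sum: "?c Y = ?c Y1 + ?c Y2"
    using linear_add[OF linear_to_complex_basis] Y12(1) by simp
  have "from_blocks \<Omega> Q P R = from_blocks w (mcnj p) p (mcnj w)"
    unfolding Y(2)[symmetric] sum wp by (rule block_eqI) (simp_all add: vec_eq_iff)
  then have "w = \<Omega>" "p = P"
    by (auto dest: arg_cong[where f = blockA] arg_cong[where f = blockC])
  moreover have "component_along (?c ` \<hh>) (?c ` \<kk>) (?c Y) = ?c Y1"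
    unfolding sum by (intro component_along_eqI sub int imageI Y12)
  moreover have "component_along (?c ` \<kk>) (?c ` \<hh>) (?c Y) = ?c Y2"
    unfolding sum add.commute[of "?c Y1"] by (intro component_along_eqI sub int imageI Y12)
  ultimately show "blockA (component_along (?c ` \<hh>) (?c ` \<kk>) (?c Y)) = \<Omega>"
    "blockC (component_along (?c ` \<kk>) (?c ` \<hh>) (?c Y)) = P"
    by (simp_all only: wp block_from_blocks)
qed

section \<open>The form \<Gamma> in the complex basis and its flatness\<close>

lemma Gamma_of_eq:
  fixes S :: "'x::euclidean_space \<Rightarrow> real^('m::finite + 'm)^('m + 'm)"
  assumes "S x \<in> symplectic_group" "S differentiable (at x)"
  shows "Gamma_of S x v = to_complex_basis (symplectic_inv (S x) ** ext_d S x v)"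
proof -
  have "ext_d (U_of S) x v = to_complex_basis (ext_d S x v)"
    using frechet_derivative_linear_image[OF bounded_linearI_linear[OF linear_to_complex_basis] assms(2)]
    by (simp add: U_of_def[abs_def])
  then show ?thesis
    by (simp add: Gamma_of_def left_invariant_form_def U_of_def left_inverse_to_complex_basis[OF assms(1)])
qed

text \<open>For \<theta> = S^(-1) dS in the real basis, the derivative of \<theta>(b) along a is
  S^(-1) times the second derivative of S, minus \<theta>(a) \<theta>(b). Antisymmetrising removes
  the second derivative and leaves minus the wedge product; the change of basis is linear and
  multiplicative.\<close>

lemma Gamma_of_flat:
  fixes S :: "'x::euclidean_space \<Rightarrow> real^('m::finite + 'm)^('m + 'm)"
  assumes X: "open X" "x \<in> X" and S: "smooth_on S X" "S ` X \<subseteq> symplectic_group"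
  shows "ext_d1 (Gamma_of S) x u v + wedge (Gamma_of S) (Gamma_of S) x u v = 0"
proof -
  let ?K = "\<lambda>y. symplectic_inv (S y)" and ?c = to_complex_basis
  define \<theta> where "\<theta> = (\<lambda>y w. ?K y ** ext_d S y w)"
  note dS = smooth_on_differentiable[OF S(1) X(1)]
  have \<Gamma>: "Gamma_of S y w = ?c (\<theta> y w)" if "y \<in> X" for y w
    unfolding \<theta>_def by (rule Gamma_of_eq) (use S(2) dS(1) that in blast)+
  have blK: "bounded_linear (symplectic_inv :: real^('m + 'm)^('m + 'm) \<Rightarrow> _)"
    by (rule bounded_linearI_linear[OF linear_symplectic_inv])
  have dK: "?K differentiable (at x)" "ext_d ?K x w = symplectic_inv (ext_d S x w)" for w
    using dS(1)[OF X(2)]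
    by (auto intro: frechet_derivative_linear_image[OF blK])
      (auto simp: differentiable_def dest: bounded_linear.has_derivative[OF blK])
  have Sx: "S x \<in> symplectic_group" using X S by blast
  have d\<theta>: "ext_d (\<lambda>y. \<theta> y b) x a =
      ?K x ** ext_d (\<lambda>y. ext_d S y b) x a - \<theta> x a ** \<theta> x b" for a b
  proof -
    \<comment> \<open>The product S^(-1) S is constant on \<open>X\<close>; differentiating it
      expresses d(S^(-1)) S through \<theta>.\<close>
    have "ext_d (\<lambda>y. ?K y ** S y) x a = ext_d (\<lambda>y. mat 1 :: real^('m + 'm)^('m + 'm)) x a"
      using S(2) by (intro frechet_derivative_congI[OF X]) (auto simp: symplectic_inv(1))
    then have "?K x ** ext_d S x a + symplectic_inv (ext_d S x a) ** S x = 0"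
      using frechet_derivative_bilinear[OF bounded_bilinear_matrix_mult dK(1) dS(1)[OF X(2)]] dK(2)
      by simp
    then have inv': "symplectic_inv (ext_d S x a) ** S x = - \<theta> x a"
      by (simp add: \<theta>_def eq_neg_iff_add_eq_0 add.commute)
    \<comment> \<open>Inserting S S^(-1) = 1 turns the product of two derivatives into a product of
      values of \<theta>.\<close>
    have "symplectic_inv (ext_d S x a) ** ext_d S x b =
        symplectic_inv (ext_d S x a) ** (S x ** ?K x) ** ext_d S x b"
      by (simp add: symplectic_inv(2)[OF Sx])
    also have "\<dots> = symplectic_inv (ext_d S x a) ** S x ** \<theta> x b"
      by (simp add: \<theta>_def matrix_mul_assoc)
    finally have "symplectic_inv (ext_d S x a) ** ext_d S x b = - (\<theta> x a ** \<theta> x b)"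
      by (simp add: inv' matrix_mult_minus_left)
    then show ?thesis
      using frechet_derivative_bilinear[OF bounded_bilinear_matrix_mult dK(1) dS(2)[OF X(2)]] dK(2)
      by (simp add: \<theta>_def)
  qed
  have d\<Gamma>: "ext_d (\<lambda>y. Gamma_of S y b) x a = ?c (ext_d (\<lambda>y. \<theta> y b) x a)" for a b
  proof -
    have "(\<lambda>y. \<theta> y b) differentiable (at x)"
      using bounded_bilinear.FDERIV[OF bounded_bilinear_matrix_mult] dK(1) dS(2)[OF X(2), of b]
      unfolding differentiable_def \<theta>_def by blast
    then have "ext_d (\<lambda>y. ?c (\<theta> y b)) x a = ?c (ext_d (\<lambda>y. \<theta> y b) x a)"
      by (rule frechet_derivative_linear_image[OF bounded_linearI_linear[OF linear_to_complex_basis]])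
    then show ?thesis
      using frechet_derivative_congI[OF X \<Gamma>] by simp
  qed
  have sym: "ext_d (\<lambda>y. ext_d S y v) x u = ext_d (\<lambda>y. ext_d S y u) x v"
    using S(1) by (intro mixed_derivatives_commute[OF X]) (simp add: smooth_on_def)
  show ?thesis
    unfolding ext_d1_def wedge_def d\<Gamma> \<Gamma>[OF X(2)] d\<theta> sym
    by (simp add: linear_diff[OF linear_to_complex_basis] to_complex_basis_mult)
qed

section \<open>Charges\<close>

definition cvec :: "real^'m \<Rightarrow> complex^'m" where
  "cvec g = (\<chi> i. complex_of_real (g $ i))"

definition vcnj :: "complex^'m \<Rightarrow> complex^'m" where
  "vcnj V = (\<chi> i. cnj (V $ i))"

lemma charges_eq: "charges S g e x = cvec g v* h_of S x - cvec e v* f_of S x"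
  by (simp add: charges_def cvec_def vec_eq_iff vector_matrix_mult_def sum_subtractf mult.commute)

lemma charges_of_id: "charges S g e x = charges id g e (S x)"
  by (simp add: charges_def f_of_def h_of_def)

text \<open>For fixed \<open>g\<close> and \<open>e\<close> the charges are real-linear in the
  matrix, so differentiating them amounts to evaluating them at dS.\<close>

lemma linear_charges: "linear (charges id g e)"
  by (rule linearI)
    (simp_all add: charges_eq linear_add[OF linear_f_mat] linear_add[OF linear_h_mat]
      linear_cmul[OF linear_f_mat] linear_cmul[OF linear_h_mat] vec_eq_iff vector_matrix_mult_def
      algebra_simps sum.distrib scaleR_sum_right scaleR_conv_of_real[where 'a = complex] sum_distrib_left)

text \<open>The charge vectors are real, so conjugation acts only on \<open>f\<close> and
  \<open>h\<close>.\<close>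

lemma vcnj_charges: "vcnj (charges S g e x) = cvec g v* mcnj (h_of S x) - cvec e v* mcnj (f_of S x)"
  by (simp add: vcnj_def charges_def cvec_def vec_eq_iff vector_matrix_mult_def sum_subtractf mult.commute)

text \<open>The structure equations are contracted with \<open>g\<close> and \<open>e\<close>; by
  reality of the latter, the coefficient of \<open>P_mat M N\<close> is the conjugate charge
  vector.\<close>

lemma charges_structure_equation:
  assumes "M \<in> symplectic_group"
  shows "charges id g e N =
    charges id g e M v* Omega_mat M N + vcnj (charges id g e M) v* P_mat M N"
  unfolding vcnj_charges unfolding charges_eq
    structure_equations(1)[OF assms, of N] structure_equations(2)[OF assms, of N]
  by (simp add: vector_matrix_mult_diff_distrib vector_matrix_mult_add_rdistrib
      vector_matrix_mul_assoc[symmetric] algebra_simps)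

section \<open>Sums over antisymmetric pairs\<close>

lemma sum_symmetric_pairs:
  fixes T :: "nat \<Rightarrow> nat \<Rightarrow> complex"
  assumes "\<And>C D. T C D = T D C" "\<And>C. T C C = 0"
  shows "(\<Sum>C=1..N. \<Sum>D=1..N. T C D) = 2 * (\<Sum>(C, D) | 1 \<le> C \<and> C < D \<and> D \<le> N. T C D)"
proof -
  let ?lt = "{(C, D). 1 \<le> C \<and> C < D \<and> D \<le> N}" and ?gt = "{(C, D). 1 \<le> D \<and> D < C \<and> C \<le> N}"
    and ?eq = "{(C, D). C = D \<and> 1 \<le> C \<and> C \<le> N}"
  \<comment> \<open>The square splits into two triangles, exchanged by the swap and hence with equal
    sums, and the diagonal, where \<open>T\<close> vanishes.\<close>
  have U: "{1..N} \<times> {1..N} = ?lt \<union> (?gt \<union> ?eq)" by auto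
  have fin: "finite ?lt" "finite ?gt" "finite ?eq"
    by (rule finite_subset[of _ "{1..N} \<times> {1..N}"]; auto)+
  have "(\<Sum>C=1..N. \<Sum>D=1..N. T C D) = (\<Sum>(C, D)\<in>{1..N} \<times> {1..N}. T C D)"
    by (simp add: sum.cartesian_product)
  also have "\<dots> = (\<Sum>(C, D)\<in>?lt. T C D) + ((\<Sum>(C, D)\<in>?gt. T C D) + (\<Sum>(C, D)\<in>?eq. T C D))"
    unfolding U using fin by (subst sum.union_disjoint; auto)+
  also have "(\<Sum>(C, D)\<in>?eq. T C D) = 0"
    by (rule sum.neutral) (auto simp: assms(2))
  also have "(\<Sum>(C, D)\<in>?gt. T C D) = (\<Sum>(C, D)\<in>?lt. T C D)"
    by (rule sum.reindex_bij_witness[of _ prod.swap prod.swap]) (auto simp: assms(1))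
  finally show ?thesis by simp
qed

text \<open>The squared signs annihilate the junk terms on the diagonal \<open>C = D\<close>, for which there is no index.\<close>

lemma sum_over_labels:
  fixes lab :: "'m::finite \<Rightarrow> label" and F :: "'m \<Rightarrow> complex"
  assumes lab: "bij_betw lab UNIV (independent_labels N n)"
  shows "(\<Sum>a\<in>UNIV. F a) = (\<Sum>I=1..n. F (index_of lab (Matter I))) +
    1/2 * (\<Sum>C=1..N. \<Sum>D=1..N. (label_sign (AutPair C D))\<^sup>2 * F (index_of lab (AutPair C D)))"
proof -
  let ?pairs = "{(C, D). 1 \<le> C \<and> C < D \<and> D \<le> N}"
  have inv: "inv lab (lab a) = a" for a
    using lab by (simp add: bij_betw_def)
  have ind: "independent_labels N n = (\<lambda>(C, D). AutPair C D) ` ?pairs \<union> Matter ` {1..n}"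
    by (auto simp: independent_labels_def)
  have fin: "finite ?pairs"
    by (rule finite_subset[of _ "{1..N} \<times> {1..N}"]) auto
  have "(\<Sum>a\<in>UNIV. F a) = (\<Sum>l\<in>independent_labels N n. F (inv lab l))"
    using sum.reindex_bij_betw[OF lab, of "\<lambda>l. F (inv lab l)"] by (simp add: inv)
  also have "\<dots> = (\<Sum>(C, D)\<in>?pairs. F (inv lab (AutPair C D))) + (\<Sum>I=1..n. F (inv lab (Matter I)))"
    unfolding ind using fin
    by (subst sum.union_disjoint) (auto simp: sum.reindex inj_on_def case_prod_unfold)
  \<comment> \<open>For C < D the sign is 1 and the label is already ordered.\<close>
  also have "(\<Sum>(C, D)\<in>?pairs. F (inv lab (AutPair C D))) =
      (\<Sum>(C, D)\<in>?pairs. (label_sign (AutPair C D))\<^sup>2 * F (index_of lab (AutPair C D)))"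
    by (rule sum.cong) (auto simp: index_of_def)
  \<comment> \<open>Ordering labels by \<open>min\<close> and \<open>max\<close> makes the summand
    symmetric, and the sign vanishes for C = D.\<close>
  also have "\<dots> = 1/2 * (\<Sum>C=1..N. \<Sum>D=1..N. (label_sign (AutPair C D))\<^sup>2 * F (index_of lab (AutPair C D)))"
    by (subst sum_symmetric_pairs) (auto simp: index_of_def min.commute max.commute)
  finally show ?thesis by (simp add: index_of_def)
qed

text \<open>Row and matrix each contribute the real sign of the summed label; the product is the
  squared sign weighting \<open>sum_over_labels\<close>, so both orderings of a pair give the same
  term and 1/2 corrects the double count.\<close>

lemma component_conjugate_row_times_matrix:
  assumes lab: "bij_betw lab UNIV (independent_labels N n)"
  shows "component lab (vcnj V v* P) l =
    (\<Sum>I=1..n. cnj (component lab V (Matter I)) * component2 lab P (Matter I) l) +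
    1/2 * (\<Sum>C=1..N. \<Sum>D=1..N.
      cnj (component lab V (AutPair C D)) * component2 lab P (AutPair C D) l)"
proof -
  have cnj_sign: "cnj (label_sign k) = label_sign k" for k
    by (cases k) auto
  have "component lab (vcnj V v* P) l =
      (\<Sum>a\<in>UNIV. label_sign l * (cnj (V $ a) * P $ a $ index_of lab l))"
    by (simp add: component_def vector_matrix_mult_def vcnj_def sum_distrib_left mult.commute)
  \<comment> \<open>The sign equation for pairs is kept folded, so that the product of two signs
    matches the square.\<close>
  then show ?thesis
    by (simp add: sum_over_labels[OF lab] component_def component2_def cnj_sign power2_eq_square mult_ac
        del: label_sign.simps(1))
qed

section \<open>Forms, covariant derivatives and charges of the coset representative\<close>

theorem mainTheorem1:
  fixes G H H_Aut H_matter \<kk> :: "(real^('m::finite + 'm)^('m + 'm)) set"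
    and \<sigma> :: "real^('m + 'm)^('m + 'm) \<Rightarrow> real^('m + 'm)^('m + 'm)"
    and X :: "'x::euclidean_space set"
    and S :: "'x \<Rightarrow> real^('m + 'm)^('m + 'm)"
    and N n :: nat
    and lab :: "'m \<Rightarrow> label"
    and f h :: "'x \<Rightarrow> complex^'m^'m"
    and U :: "'x \<Rightarrow> complex^('m + 'm)^('m + 'm)"
    and \<Gamma> :: "'x \<Rightarrow> 'x \<Rightarrow> complex^('m + 'm)^('m + 'm)"
    and \<Omega> P \<omega> :: "'x \<Rightarrow> 'x \<Rightarrow> complex^'m^'m"
    and Z :: "real^'m \<Rightarrow> real^'m \<Rightarrow> 'x \<Rightarrow> complex^'m"
  assumes "G \<subseteq> symplectic_group"
    and "symmetric_pair G H \<sigma>"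
    and "\<kk> = minus_eigenspace G \<sigma>"
    and "cartan_decomposition (lie_algebra G) (lie_algebra H) \<kk>"
    and "product_group H H_Aut H_matter"
    and "bij_betw lab UNIV (independent_labels N n)"
    and "adapted_embedding lab (lie_algebra H) \<kk>"
    and "coset_representative G H X S"
    and f: "f = f_of S" and h: "h = h_of S" and U: "U = U_of S"
    and \<Gamma>: "\<Gamma> = left_invariant_form U"
    and \<Omega>: "\<Omega> = (\<lambda>x v. cscale \<i> (dagger (f x) ** ext_d h x v - dagger (h x) ** ext_d f x v))"
    and P: "P = (\<lambda>x v. cscale (- \<i>) (transpose (f x) ** ext_d h x v - transpose (h x) ** ext_d f x v))"
    and \<omega>: "\<omega> = H_connection (lie_algebra H) \<kk> S"
    and Z: "Z = charges S"
  shows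
    "(\<forall>x\<in>X. U x = cscale (1 / sqrt 2) (from_blocks
        (f x + cscale \<i> (h x)) (mcnj (f x) + cscale \<i> (mcnj (h x)))
        (f x - cscale \<i> (h x)) (mcnj (f x) - cscale \<i> (mcnj (h x))))) \<and>
     (\<forall>x\<in>X. \<forall>u v. ext_d1 \<Gamma> x u v + wedge \<Gamma> \<Gamma> x u v = 0) \<and>
     (\<forall>x\<in>X. \<forall>v. \<Gamma> x v = from_blocks (\<Omega> x v) (mcnj (P x v)) (P x v) (mcnj (\<Omega> x v))) \<and>
     (\<forall>x\<in>X. \<forall>v. \<Omega> x v = \<omega> x v) \<and>
     (\<forall>x\<in>X. \<forall>v. P x v = embedded_vielbein (lie_algebra H) \<kk> S x v) \<and>
     (\<forall>x\<in>X. \<forall>v. nabla_mat \<omega> f x v = mcnj (f x) ** P x v) \<and>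
     (\<forall>x\<in>X. \<forall>v. nabla_mat \<omega> h x v = mcnj (h x) ** P x v) \<and>
     (\<forall>g e. \<forall>x\<in>X. \<forall>v.
        (\<forall>A\<in>{1..N}. \<forall>B\<in>{1..N}.
           component lab (nabla_row \<omega> (Z g e) x v) (AutPair A B) =
             (\<Sum>I=1..n. cnj (component lab (Z g e x) (Matter I)) * component2 lab (P x v) (Matter I) (AutPair A B))
             + 1/2 * (\<Sum>C=1..N. \<Sum>D=1..N.
                 cnj (component lab (Z g e x) (AutPair C D)) * component2 lab (P x v) (AutPair C D) (AutPair A B))) \<and>
        (\<forall>I\<in>{1..n}.
           component lab (nabla_row \<omega> (Z g e) x v) (Matter I) =
             1/2 * (\<Sum>A=1..N. \<Sum>B=1..N.
                 cnj (component lab (Z g e x) (AutPair A B)) * component2 lab (P x v) (AutPair A B) (Matter I))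
             + (\<Sum>J=1..n. cnj (component lab (Z g e x) (Matter J)) * component2 lab (P x v) (Matter J) (Matter I))))"
proof -
  have X: "open X" and S: "smooth_on S X" "S ` X \<subseteq> G"
    using \<open>coset_representative G H X S\<close> by (auto simp: coset_representative_def)
  have Sp: "S x \<in> symplectic_group" if "x \<in> X" for x
    using S(2) \<open>G \<subseteq> symplectic_group\<close> that by blast
  have Spx: "S ` X \<subseteq> symplectic_group" using Sp by blast
  have G: "matrix_lie_group G"
    using \<open>symmetric_pair G H \<sigma>\<close> by (simp add: symmetric_pair_def)
  note dS = smooth_on_differentiable(1)[OF S(1) X]
  have fhZ: "f = (\<lambda>x. f_mat (S x))" "h = (\<lambda>x. h_mat (S x))"
    "charges S = (\<lambda>g e x. charges id g e (S x))"
    by (simp_all add: fun_eq_iff f h f_of_eq[of S] h_of_eq[of S] charges_of_id[of S])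
  have d: "ext_d f x v = f_mat (ext_d S x v)" "ext_d h x v = h_mat (ext_d S x v)"
    "ext_d (charges S g e) x v = charges id g e (ext_d S x v)" if "x \<in> X" for x v g e
    using frechet_derivative_linear_image[OF bounded_linearI_linear[OF linear_f_mat] dS[OF that]]
      frechet_derivative_linear_image[OF bounded_linearI_linear[OF linear_h_mat] dS[OF that]]
      frechet_derivative_linear_image[OF bounded_linearI_linear[OF linear_charges] dS[OF that]]
    by (simp_all add: fhZ)
  have \<Gamma>_eq: "\<Gamma> = Gamma_of S"
    by (simp add: \<Gamma> U Gamma_of_def)
  have \<Omega>P: "\<Omega> x v = Omega_mat (S x) (ext_d S x v)" "P x v = P_mat (S x) (ext_d S x v)" if "x \<in> X" for x v
    by (simp_all add: \<Omega> P Omega_mat_def P_mat_def d[OF that]) (simp_all add: fhZ)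
  have blocks: "to_complex_basis (symplectic_inv (S x) ** ext_d S x v) =
      from_blocks (\<Omega> x v) (mcnj (P x v)) (P x v) (mcnj (\<Omega> x v))" if "x \<in> X" for x v
    by (simp add: to_complex_basis_blocks \<Omega>P[OF that])
  have \<Gamma>_blocks: "\<Gamma> x v = to_complex_basis (symplectic_inv (S x) ** ext_d S x v)" if "x \<in> X" for x v
    unfolding \<Gamma>_eq by (rule Gamma_of_eq[OF Sp[OF that] dS[OF that]])
  have alg: "symplectic_inv (S x) ** ext_d S x v \<in> lie_algebra G" if "x \<in> X" for x v
    using left_invariant_form_in_lie_algebra[OF G X that S] symplectic_inv(3)[OF Sp[OF that]]
    by (simp add: left_invariant_form_def)
  \<comment> \<open>S^(-1) dS lies in the Lie algebra of \<open>G\<close> and its blocks in the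
    complex basis are known, so its two components can be read off.\<close>
  have \<omega>_eq: "\<omega> x v = \<Omega> x v" and P_eq: "embedded_vielbein (lie_algebra H) \<kk> S x v = P x v"
    if "x \<in> X" for x v
    using components_of_adapted_form[OF \<open>cartan_decomposition (lie_algebra G) (lie_algebra H) \<kk>\<close>
        \<open>adapted_embedding lab (lie_algebra H) \<kk>\<close> alg[OF that] blocks[OF that]]
      \<Gamma>_blocks[OF that, unfolded \<Gamma>_eq]
    by (simp_all add: \<omega> H_connection_def embedded_vielbein_def)
  \<comment> \<open>The connection term being subtracted is the \<Omega> term of the structure
    equations; the \<open>P\<close> term remains.\<close>
  have nabla: "nabla_mat \<omega> f x v = mcnj (f x) ** P x v" "nabla_mat \<omega> h x v = mcnj (h x) ** P x v"
    "nabla_row \<omega> (Z g e) x v = vcnj (Z g e x) v* P x v" if "x \<in> X" for x v g e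
    using structure_equations[OF Sp[OF that], of "ext_d S x v"]
      charges_structure_equation[OF Sp[OF that], of g e "ext_d S x v"]
    by (simp_all add: nabla_mat_def nabla_row_def \<omega>_eq \<Omega>P Z d that)
      (simp_all add: fhZ)
  have lab: "bij_betw lab UNIV (independent_labels N n)" by fact
  show ?thesis
  proof (intro conjI allI ballI)
    show "ext_d1 \<Gamma> x u v + wedge \<Gamma> \<Gamma> x u v = 0" if "x \<in> X" for x u v
      unfolding \<Gamma>_eq by (rule Gamma_of_flat[OF X that S(1) Spx])
  \<comment> \<open>\<open>add.commute\<close> reconciles the different orders of the pair and
    matter sums in the two charge equations.\<close>
  qed (simp_all add: U_of_blocks U f h \<Gamma>_blocks blocks \<omega>_eq P_eq nabla
      component_conjugate_row_times_matrix[OF lab] add.commute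
      flip: f h)
qed

end
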